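(* For every $A\subset\mathbb{R}^n$ and every $x\in\overline A$, \[ \dim_{\mathrm{Pvec}}\{x\}_A\le \dim_{\times}\{x\}_A\le \dim_{\mathrm{Ptan}}\{x\}_A. \] Consequently, \[ \dim_{\mathrm{Pvec}}(A)\le \dim_{\times}(A)\le \dim_{\mathrm{Ptan}}(A). \]
   Context: Point-vector dimension: $\dim_{\mathrm{Pvec}}\{x\}_A$ is the maximal $k\in\{1,\dots,n\}$ such that there exist linearly independent $v_1,\dots,v_k\in\mathbb{R}^n$ and $\delta>0$ with $\{x+tv_i:0<t<\delta\}\subset A$ for every $i$; it is $0$ if no such $k$ exists. Tangent cone: $\mathrm{Tan}_x(A)$ is the set of $v\in\mathbb{R}^n$ for which there exist $x_k\in A$, $x_k\to x$, and positive reals $\lambda_k\downarrow0$ with $(x_k-x)/\lambda_k\to v$. Point-tangential dimension: $\dim_{\mathrm{Ptan}}\{x\}_A:=\dim\mathrm{span}(\mathrm{Tan}_x(A))$, with $\mathrm{span}(\varnothing)=\{0\}$. Effective directions: $\mathrm{Eff}_x(A):=\mathrm{Tan}_x(A)\cap S^{n-1}$ if $x\in\overline A$ (and $\varnothing$ otherwise). For $v\ne0$ let $[v]=\mathbb{R}v\in\mathbb{P}^{n-1}$; $\mathrm{Eff}_x^{\mathbb P}(A):=\{[v]:v\in\mathrm{Eff}_x(A)\}$. Admissible probes: for $x\in\overline A$, $v\in S^{n-1}$, $\mathcal G_x^A(v)$ is the family of all injective Lipschitz maps $\gamma:[0,\delta]\to\mathbb{R}^n$ (some $\delta>0$) with $\gamma(0)=x$,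 $\lim_{t\to0^+}\frac{\gamma(t)-x}{\|\gamma(t)-x\|}=v$, and $A\cap\gamma((0,\eta])\ne\varnothing$ for every $\eta\in(0,\delta]$; $\Gamma_\gamma:=\gamma([0,\delta])$. Point-extended box dimension: for bounded $E$, $N_\varepsilon(E)$ is the minimal number of sets of diameter at most $\varepsilon$ covering $E$ and $\overline{\dim}_B(E):=\limsup_{\varepsilon\to0}\frac{\ln N_\varepsilon(E)}{\ln(1/\varepsilon)}$. For $x\in\overline E$, $\dim_{\mathrm{Pbox}}\{x\}_E:=\inf_{r>0}\overline{\dim}_B(E\cap B(x,r))$; it is $0$ if $x\notin\overline E$. Directional contribution: for $v\in\mathrm{Eff}_x(A)$, $\theta_x^A(v):=\sup_{\gamma\in\mathcal G_x^A(v)}\dim_{\mathrm{Pbox}}\{x\}_{A\cap\Gamma_\gamma}$; for $\xi\in\mathrm{Eff}_x^{\mathbb P}(A)$, $\theta_x^A(\xi):=\sup\{\theta_x^A(w):w\in\mathrm{Eff}_x(A),[w]=\xi\}$. Point-Cross dimension at $x\in\overline A$: $\dim_\times\{x\}_A:=\sup\sum_{i=1}^m\theta_x^A(\xi_i)$ over all $m\in\{0,\dots,n\}$ and all $\xi_1,\dots,\xi_m\in\mathrm{Eff}_x^{\mathbb P}(A)$ that are projectively (linearly) independent, i.e. nonzero representatives are linearly independent (empty family allowed, with sum $0$). Global versions: $\dim_{\mathrm{Pvec}}(A)$, $\dim_\times(A)$, $\dim_{\mathrm{Ptan}}(A)$ are the suprema over $x\in\overline A$ of the corresponding pointwise quantities,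 and equal $0$ if $A=\varnothing$. *)

theory Defs
  imports "HOL-Analysis.Analysis"
begin

(* Indexed-family independence: injectivity is needed because "independent" is a
   predicate on sets and does not see repetitions. *)
definition lin_indep_family :: "nat \<Rightarrow> (nat \<Rightarrow> real ^ 'n) \<Rightarrow> bool" where
  "lin_indep_family k v \<longleftrightarrow> inj_on v {1..k} \<and> independent (v ` {1..k})"

definition pvec_admissible :: "(real ^ 'n) set \<Rightarrow> real ^ 'n \<Rightarrow> nat \<Rightarrow> bool" where
  "pvec_admissible A x k \<longleftrightarrow>
     (\<exists>v. lin_indep_family k v \<and>
       (\<exists>\<delta>>0. \<forall>i\<in>{1..k}. {x + t *\<^sub>R v i | t. 0 < t \<and> t < \<delta>} \<subseteq> A))"

definition pvec_dim_at :: "(real ^ 'n) set \<Rightarrow> real ^ 'n \<Rightarrow> nat" where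
  "pvec_dim_at A x =
     (let K = {k \<in> {1..CARD('n)}. pvec_admissible A x k}
      in if K = {} then 0 else Max K)"

definition tangent_cone :: "(real ^ 'n) set \<Rightarrow> real ^ 'n \<Rightarrow> (real ^ 'n) set" where
  "tangent_cone A x =
     {v. \<exists>X l. (\<forall>k. X k \<in> A) \<and> X \<longlonglongrightarrow> x \<and>
           (\<forall>k. 0 < l k) \<and> decseq l \<and> l \<longlonglongrightarrow> (0::real) \<and>
           (\<lambda>k. (X k - x) /\<^sub>R l k) \<longlonglongrightarrow> v}"

definition ptan_dim_at :: "(real ^ 'n) set \<Rightarrow> real ^ 'n \<Rightarrow> nat" where
  "ptan_dim_at A x = dim (span (tangent_cone A x))"

definition eff_dirs :: "(real ^ 'n) set \<Rightarrow> real ^ 'n \<Rightarrow> (real ^ 'n) set" where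
  "eff_dirs A x = (if x \<in> closure A then tangent_cone A x \<inter> sphere 0 1 else {})"

(* Points of projective space are represented by the lines they are: [v] = span {v}
   for nonzero v. *)
definition proj_eff_dirs :: "(real ^ 'n) set \<Rightarrow> real ^ 'n \<Rightarrow> (real ^ 'n) set set" where
  "proj_eff_dirs A x = (\<lambda>v. span {v}) ` eff_dirs A x"

(* A probe \<gamma> : [0,\<delta>] \<rightarrow> R^n is a pair (\<delta>, \<gamma>); the values of \<gamma> outside [0,\<delta>] are never used. *)
definition probes ::
    "(real ^ 'n) set \<Rightarrow> real ^ 'n \<Rightarrow> real ^ 'n \<Rightarrow> (real \<times> (real \<Rightarrow> real ^ 'n)) set" where
  "probes A x v =
     {(\<delta>, \<gamma>). 0 < \<delta> \<and> inj_on \<gamma> {0..\<delta>} \<and> (\<exists>L. L-lipschitz_on {0..\<delta>} \<gamma>) \<and> \<gamma> 0 = x \<and>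
        ((\<lambda>t. (\<gamma> t - x) /\<^sub>R norm (\<gamma> t - x)) \<longlongrightarrow> v) (at_right 0) \<and>
        (\<forall>\<eta>\<in>{0<..\<delta>}. A \<inter> \<gamma> ` {0<..\<eta>} \<noteq> {})}"

(* "diameter" is a meaningless real number on unbounded sets, hence the condition "bounded U". *)
definition covering_num :: "real \<Rightarrow> (real ^ 'n) set \<Rightarrow> nat" where
  "covering_num \<epsilon> E =
     (LEAST N. \<exists>\<U>. finite \<U> \<and> card \<U> = N \<and> E \<subseteq> \<Union>\<U> \<and>
        (\<forall>U\<in>\<U>. bounded U \<and> diameter U \<le> \<epsilon>))"

definition upper_box_dim :: "(real ^ 'n) set \<Rightarrow> ereal" where
  "upper_box_dim E =
     Limsup (at_right 0) (\<lambda>\<epsilon>. ereal (ln (real (covering_num \<epsilon> E)) / ln (1 / \<epsilon>)))"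

definition pbox_dim_at :: "(real ^ 'n) set \<Rightarrow> real ^ 'n \<Rightarrow> ereal" where
  "pbox_dim_at E x =
     (if x \<in> closure E then (INF r\<in>{0<..}. upper_box_dim (E \<inter> ball x r)) else 0)"

definition theta :: "(real ^ 'n) set \<Rightarrow> real ^ 'n \<Rightarrow> real ^ 'n \<Rightarrow> ereal" where
  "theta A x v = (SUP (\<delta>, \<gamma>)\<in>probes A x v. pbox_dim_at (A \<inter> \<gamma> ` {0..\<delta>}) x)"

definition proj_theta :: "(real ^ 'n) set \<Rightarrow> real ^ 'n \<Rightarrow> (real ^ 'n) set \<Rightarrow> ereal" where
  "proj_theta A x \<xi> = (SUP w\<in>{w \<in> eff_dirs A x. span {w} = \<xi>}. theta A x w)"

definition proj_indep :: "nat \<Rightarrow> (nat \<Rightarrow> (real ^ 'n) set) \<Rightarrow> bool" where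
  "proj_indep m \<xi> \<longleftrightarrow>
     (\<exists>u. (\<forall>i\<in>{1..m}. u i \<noteq> 0 \<and> span {u i} = \<xi> i) \<and> lin_indep_family m u)"

definition cross_dim_at :: "(real ^ 'n) set \<Rightarrow> real ^ 'n \<Rightarrow> ereal" where
  "cross_dim_at A x =
     Sup {\<Sum>i=1..m. proj_theta A x (\<xi> i) | m \<xi>.
            m \<le> CARD('n) \<and> (\<forall>i\<in>{1..m}. \<xi> i \<in> proj_eff_dirs A x) \<and> proj_indep m \<xi>}"

definition pvec_dim :: "(real ^ 'n) set \<Rightarrow> ereal" where
  "pvec_dim A = (if A = {} then 0 else (SUP x\<in>closure A. ereal (real (pvec_dim_at A x))))"

definition cross_dim :: "(real ^ 'n) set \<Rightarrow> ereal" where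
  "cross_dim A = (if A = {} then 0 else (SUP x\<in>closure A. cross_dim_at A x))"

definition ptan_dim :: "(real ^ 'n) set \<Rightarrow> ereal" where
  "ptan_dim A = (if A = {} then 0 else (SUP x\<in>closure A. ereal (real (ptan_dim_at A x))))"

end

(* Upper bound: a probe is Lipschitz on a compact interval, so every subset of its image has upper
   box dimension at most 1; hence every direction contributes at most 1, and independent effective
   directions span a subspace of the span of the tangent cone.
   Lower bound: a segment {x + tv : 0 < t < \<delta>} contained in A is itself a probe in the direction
   v/|v|, and every neighbourhood of x contains a subsegment, which has box dimension 1. *)
theory Submission
  imports Defs "HOL-Real_Asymp.Real_Asymp"
begin

section \<open>Covering numbers and upper box dimension of Lipschitz curves and segments\<close>

lemma covering_num_le:
  assumes "finite \<U>" "E \<subseteq> \<Union>\<U>" "\<And>U. U \<in> \<U> \<Longrightarrow> bounded U \<and> diameter U \<le> \<epsilon>"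
  shows "covering_num \<epsilon> E \<le> card \<U>"
  unfolding covering_num_def by (rule Least_le) (use assms in blast)

text \<open>A \<open>LEAST\<close> is attained only once some candidate exists. Total boundedness of
  the compact set \<open>closure E\<close> supplies one: finitely many balls of radius
  \<open>\<epsilon>/2\<close>.\<close>

lemma covering_num_witness:
  fixes E :: "(real ^ 'n) set"
  assumes "bounded E" "0 < \<epsilon>"
  obtains \<U> where "finite \<U>" "card \<U> = covering_num \<epsilon> E" "E \<subseteq> \<Union>\<U>"
    "\<And>U. U \<in> \<U> \<Longrightarrow> bounded U \<and> diameter U \<le> \<epsilon>"
proof -
  have "compact (closure E)"
    using assms by (simp add: compact_closure)
  then obtain F where F: "finite F" "closure E \<subseteq> (\<Union>y\<in>F. ball y (\<epsilon>/2))"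
    using assms unfolding compact_eq_totally_bounded by (metis half_gt_zero)
  have "\<exists>\<U>. finite \<U> \<and> card \<U> = card ((\<lambda>y. ball y (\<epsilon>/2)) ` F) \<and> E \<subseteq> \<Union>\<U> \<and>
        (\<forall>U\<in>\<U>. bounded U \<and> diameter U \<le> \<epsilon>)"
    using F closure_subset[of E] assms
    by (intro exI[of _ "(\<lambda>y. ball y (\<epsilon>/2)) ` F"]) (auto simp: diameter_ball)
  from LeastI[of "\<lambda>N. \<exists>\<U>. finite \<U> \<and> card \<U> = N \<and> E \<subseteq> \<Union>\<U> \<and>
        (\<forall>U\<in>\<U>. bounded U \<and> diameter U \<le> \<epsilon>)", OF this]
  show ?thesis
    using that unfolding covering_num_def by blast
qed

text \<open>Cut the parameter interval into pieces of length \<open>h\<close>, short enough that the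
  Lipschitz bound gives each image diameter at most \<epsilon>, and count the pieces.\<close>

lemma covering_num_lipschitz_image:
  fixes \<gamma> :: "real \<Rightarrow> real ^ 'n"
  assumes lip: "L-lipschitz_on {0..\<delta>} \<gamma>" and \<delta>: "0 < \<delta>" and \<epsilon>: "0 < \<epsilon>"
    and E: "E \<subseteq> \<gamma> ` {0..\<delta>}"
  shows "real (covering_num \<epsilon> E) \<le> \<delta> * (L + 1) / \<epsilon> + 2"
proof -
  have L: "0 \<le> L"
    using lip lipschitz_on_nonneg by blast
  \<comment> \<open>Dividing by \<open>L + 1\<close> keeps \<open>h\<close> positive also when
    \<open>L = 0\<close>.\<close>
  define h where "h = \<epsilon> / (L + 1)"
  have h: "0 < h"
    using L \<epsilon> by (simp add: h_def)
  have Lh: "L * h \<le> \<epsilon>"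
    using L \<epsilon> by (simp add: h_def field_simps)
  \<comment> \<open>The last piece may stick out beyond \<delta>, where nothing is known about
    \<gamma>; hence the intersection with \<open>{0..\<delta>}\<close>.\<close>
  define P where "P j = \<gamma> ` ({real j * h..(real j + 1) * h} \<inter> {0..\<delta>})" for j :: nat
  define n where "n = nat \<lfloor>\<delta> / h\<rfloor>"
  have P: "bounded (P j) \<and> diameter (P j) \<le> \<epsilon>" for j
  proof
    have "continuous_on {0..\<delta>} \<gamma>"
      using lip lipschitz_on_continuous_on by blast
    then have "compact (\<gamma> ` {0..\<delta>})"
      by (intro compact_continuous_image) auto
    then show "bounded (P j)"
      by (rule bounded_subset[OF compact_imp_bounded]) (auto simp: P_def)
    show "diameter (P j) \<le> \<epsilon>"
    proof (rule diameter_le)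
      fix p q assume "p \<in> P j" "q \<in> P j"
      then obtain s t where st: "p = \<gamma> s" "q = \<gamma> t" "s \<in> {0..\<delta>}" "t \<in> {0..\<delta>}"
        "s \<in> {real j * h..(real j + 1) * h}" "t \<in> {real j * h..(real j + 1) * h}"
        by (auto simp: P_def)
      have "dist s t \<le> h"
        using st by (auto simp: dist_real_def algebra_simps)
      then have "dist p q \<le> L * h"
        using lipschitz_onD[OF lip st(3,4)] L st by (meson mult_left_mono order_trans)
      then show "norm (p - q) \<le> \<epsilon>"
        using Lh by (simp add: dist_norm)
    qed (use \<epsilon> in auto)
  qed
  have "E \<subseteq> \<Union> (P ` {..n})"
  proof
    fix p assume "p \<in> E"
    then obtain t where t: "p = \<gamma> t" "0 \<le> t" "t \<le> \<delta>"
      using E by auto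
    define j where "j = nat \<lfloor>t / h\<rfloor>"
    have j: "real j \<le> t / h" "t / h < real j + 1"
      using t h by (simp_all add: j_def)
    have "j \<le> n"
      unfolding j_def n_def using t h by (intro nat_mono floor_mono divide_right_mono) auto
    moreover have "p \<in> P j"
      using j t h by (auto simp: P_def field_simps)
    ultimately show "p \<in> \<Union> (P ` {..n})"
      by blast
  qed
  then have "covering_num \<epsilon> E \<le> card (P ` {..n})"
    using P by (intro covering_num_le) auto
  also have "\<dots> \<le> Suc n"
    using card_image_le[of "{..n}" P] by simp
  finally have "real (covering_num \<epsilon> E) \<le> real n + 1"
    by linarith
  also have "real n \<le> \<delta> / h"
    using \<delta> h by (simp add: n_def)
  finally show ?thesis
    by (simp add: h_def)
qed

text \<open>The covering number is at most \<open>K / \<epsilon> + 2\<close>; on the logarithmic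
  scale the constants vanish and only the exponent 1 of \<open>1 / \<epsilon>\<close>
  survives.\<close>

lemma upper_box_dim_lipschitz_image_le_1:
  fixes \<gamma> :: "real \<Rightarrow> real ^ 'n"
  assumes lip: "L-lipschitz_on {0..\<delta>} \<gamma>" and \<delta>: "0 < \<delta>" and E: "E \<subseteq> \<gamma> ` {0..\<delta>}"
  shows "upper_box_dim E \<le> 1"
proof -
  define K where "K = \<delta> * (L + 1)"
  have K: "0 < K"
    using lipschitz_on_nonneg[OF lip] \<delta> by (simp add: K_def)
  have lim: "((\<lambda>\<epsilon>. ln (K / \<epsilon> + 2) / ln (1 / \<epsilon>)) \<longlongrightarrow> 1) (at_right 0)"
    using K by real_asymp
  have "eventually (\<lambda>\<epsilon>::real. 0 < \<epsilon> \<and> \<epsilon> < 1) (at_right 0)"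
    using eventually_at_right_less[of "0::real"] eventually_at_right_field[of _ "0::real"]
    by (auto intro: exI[of _ 1])
  then have "upper_box_dim E
      \<le> Limsup (at_right 0) (\<lambda>\<epsilon>. ereal (ln (K / \<epsilon> + 2) / ln (1 / \<epsilon>)))"
    unfolding upper_box_dim_def
  proof (intro Limsup_mono, elim eventually_mono)
    fix \<epsilon> :: real assume \<epsilon>: "0 < \<epsilon> \<and> \<epsilon> < 1"
    have N: "real (covering_num \<epsilon> E) \<le> K / \<epsilon> + 2"
      using covering_num_lipschitz_image[OF lip \<delta> _ E] \<epsilon> by (simp add: K_def)
    have "ln (real (covering_num \<epsilon> E)) \<le> ln (K / \<epsilon> + 2)"
    \<comment> \<open>This happens for empty \<open>E\<close>. Then the left side is
      \<open>ln 0\<close>, which is 0 by convention, and the right side is positive because its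
      argument exceeds 1.\<close>
    proof (cases "covering_num \<epsilon> E = 0")
      case True
      then show ?thesis using K \<epsilon> by simp
    next
      case False
      then show ?thesis using N by (intro ln_mono) auto
    qed
    then show "ereal (ln (real (covering_num \<epsilon> E)) / ln (1 / \<epsilon>)) \<le> ereal (ln (K / \<epsilon> + 2) / ln (1 / \<epsilon>))"
      using \<epsilon> by (auto intro!: divide_right_mono)
  qed
  also have "\<dots> = 1"
    using lim by (intro lim_imp_Limsup) (auto simp: one_ereal_def)
  finally show ?thesis .
qed

text \<open>Since \<open>norm w = 1\<close>, the map sending \<open>t\<close> to
  \<open>x + t *\<^sub>R w\<close> is an isometry, so a covering set captures only parameters within
  \<epsilon> of any one of them. Thus \<open>{0<..<s}\<close> is covered by intervals of length
  \<open>2 * \<epsilon>\<close>, and comparing Lebesgue measures gives the bound.\<close>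

lemma covering_num_segment:
  fixes x w :: "real ^ 'n"
  assumes E: "bounded E" and w: "norm w = 1" and \<epsilon>: "0 < \<epsilon>" and s: "0 < s"
    and seg: "\<And>t. 0 < t \<Longrightarrow> t < s \<Longrightarrow> x + t *\<^sub>R w \<in> E"
  shows "s \<le> 2 * \<epsilon> * real (covering_num \<epsilon> E)"
proof -
  obtain \<U> where \<U>: "finite \<U>" "card \<U> = covering_num \<epsilon> E" "E \<subseteq> \<Union>\<U>"
    "\<And>U. U \<in> \<U> \<Longrightarrow> bounded U \<and> diameter U \<le> \<epsilon>"
    using covering_num_witness[OF E \<epsilon>] by metis
  \<comment> \<open>If \<open>U\<close> misses the line, \<open>c U\<close> is arbitrary; its
    interval still has length \<open>2 * \<epsilon>\<close>, so the count is unaffected.\<close>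
  define c where "c U = (SOME t. x + t *\<^sub>R w \<in> U)" for U
  have "{0<..<s} \<subseteq> (\<Union>U\<in>\<U>. {c U - \<epsilon>..c U + \<epsilon>})"
  proof
    fix t assume "t \<in> {0<..<s}"
    then obtain U where U: "U \<in> \<U>" "x + t *\<^sub>R w \<in> U"
      using seg \<U>(3) by fastforce
    then have "x + c U *\<^sub>R w \<in> U"
      unfolding c_def by (metis someI)
    then have "dist (x + t *\<^sub>R w) (x + c U *\<^sub>R w) \<le> \<epsilon>"
      using diameter_bounded_bound[of U] U \<U>(4) by (meson order_trans)
    then have "\<bar>t - c U\<bar> \<le> \<epsilon>"
      using w by (simp add: dist_norm flip: scaleR_diff_left)
    then show "t \<in> (\<Union>U\<in>\<U>. {c U - \<epsilon>..c U + \<epsilon>})"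
      using U by (auto simp: abs_le_iff intro!: bexI[of _ U])
  qed
  then have "measure lborel {0<..<s} \<le> measure lborel (\<Union>U\<in>\<U>. {c U - \<epsilon>..c U + \<epsilon>})"
    using \<U>(1) \<epsilon> by (intro measure_mono_fmeasurable fmeasurable.finite_UN) (auto simp: fmeasurable_def)
  also have "\<dots> \<le> (\<Sum>U\<in>\<U>. measure lborel {c U - \<epsilon>..c U + \<epsilon>})"
    using \<U>(1) by (intro measure_UNION_le) auto
  also have "\<dots> = 2 * \<epsilon> * real (card \<U>)"
    using \<epsilon> by simp
  finally show ?thesis
    using s \<U>(2) by simp
qed

text \<open>The covering number is at least \<open>s / (2 * \<epsilon>)\<close>, and the factor
  \<open>s / 2\<close> disappears in the logarithmic limit.\<close>

lemma upper_box_dim_segment_ge_1: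
  fixes x w :: "real ^ 'n"
  assumes E: "bounded E" and w: "norm w = 1" and s: "0 < s"
    and seg: "\<And>t. 0 < t \<Longrightarrow> t < s \<Longrightarrow> x + t *\<^sub>R w \<in> E"
  shows "1 \<le> upper_box_dim E"
proof -
  have lim: "((\<lambda>\<epsilon>. ln (s / (2 * \<epsilon>)) / ln (1 / \<epsilon>)) \<longlongrightarrow> 1) (at_right 0)"
    using s by real_asymp
  have ev: "eventually (\<lambda>\<epsilon>::real. 0 < \<epsilon> \<and> \<epsilon> < 1) (at_right 0)"
    using eventually_at_right_less[of "0::real"] eventually_at_right_field[of _ "0::real"]
    by (auto intro: exI[of _ 1])
  have "1 = Limsup (at_right 0) (\<lambda>\<epsilon>. ereal (ln (s / (2 * \<epsilon>)) / ln (1 / \<epsilon>)))"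
    using lim by (intro lim_imp_Limsup[symmetric]) (auto simp: one_ereal_def)
  also have "\<dots> \<le> upper_box_dim E"
    unfolding upper_box_dim_def using ev
  proof (intro Limsup_mono, elim eventually_mono)
    fix \<epsilon> :: real assume \<epsilon>: "0 < \<epsilon> \<and> \<epsilon> < 1"
    have "s / (2 * \<epsilon>) \<le> real (covering_num \<epsilon> E)"
      using covering_num_segment[OF E w _ s seg, of \<epsilon>] \<epsilon> by (simp add: field_simps)
    then have "ln (s / (2 * \<epsilon>)) \<le> ln (real (covering_num \<epsilon> E))"
      using \<epsilon> s by (intro ln_mono) auto
    then show "ereal (ln (s / (2 * \<epsilon>)) / ln (1 / \<epsilon>))
        \<le> ereal (ln (real (covering_num \<epsilon> E)) / ln (1 / \<epsilon>))"
      using \<epsilon> by (auto intro!: divide_right_mono)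
  qed
  finally show ?thesis .
qed

section \<open>Directional contributions and the bound by the tangential dimension\<close>

text \<open>The pointwise box dimension is an infimum over radii, so the single radius 1 bounds it.
  With no probes the supremum is \<open>-\<infinity>\<close>, which also satisfies the
  bound.\<close>

lemma theta_le_1: "theta A x v \<le> 1"
proof -
  have "pbox_dim_at (A \<inter> \<gamma> ` {0..\<delta>}) x \<le> 1" if "(\<delta>, \<gamma>) \<in> probes A x v" for \<delta> \<gamma>
  proof -
    obtain L where "L-lipschitz_on {0..\<delta>} \<gamma>" "0 < \<delta>"
      using \<open>(\<delta>, \<gamma>) \<in> probes A x v\<close> by (auto simp: probes_def)
    then have "upper_box_dim (A \<inter> \<gamma> ` {0..\<delta>} \<inter> ball x 1) \<le> 1"
      by (intro upper_box_dim_lipschitz_image_le_1[of L \<delta> \<gamma>]) auto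
    then have "(INF r\<in>{0<..}. upper_box_dim (A \<inter> \<gamma> ` {0..\<delta>} \<inter> ball x r)) \<le> 1"
      by (intro INF_lower2[of 1]) auto
    then show ?thesis
      by (simp add: pbox_dim_at_def)
  qed
  then show ?thesis
    unfolding theta_def by (intro SUP_least) auto
qed

lemma proj_theta_le_1: "proj_theta A x \<xi> \<le> 1"
  unfolding proj_theta_def by (intro SUP_least theta_le_1)

lemma cross_dim_at_le_ptan_dim_at:
  fixes A :: "(real ^ 'n) set"
  shows "cross_dim_at A x \<le> ereal (real (ptan_dim_at A x))"
  unfolding cross_dim_at_def
proof (rule Sup_least, clarify)
  fix m and \<xi> :: "nat \<Rightarrow> (real ^ 'n) set"
  assume \<xi>: "\<forall>i\<in>{1..m}. \<xi> i \<in> proj_eff_dirs A x" and "proj_indep m \<xi>"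
  then obtain u where u: "\<And>i. i \<in> {1..m} \<Longrightarrow> span {u i} = \<xi> i"
    and inj: "inj_on u {1..m}" and indep: "independent (u ` {1..m})"
    unfolding proj_indep_def lin_indep_family_def by blast
  \<comment> \<open>The representative \<open>u i\<close> need not be tangent itself: it only spans
    the same line as some effective direction \<open>v\<close>. Membership in the span is enough for
    counting dimensions.\<close>
  have "u i \<in> span (tangent_cone A x)" if i: "i \<in> {1..m}" for i
  proof -
    have "\<xi> i \<in> proj_eff_dirs A x"
      using \<xi> i by blast
    then obtain v where "v \<in> tangent_cone A x" "\<xi> i = span {v}"
      by (auto simp: proj_eff_dirs_def eff_dirs_def split: if_splits)
    then have "u i \<in> span {v}"
      using u[OF i] span_base[of "u i" "{u i}"] by simp
    then show ?thesis
      using span_mono[of "{v}" "tangent_cone A x"] \<open>v \<in> tangent_cone A x\<close> by blast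
  qed
  then have "card (u ` {1..m}) \<le> dim (span (tangent_cone A x))"
    by (intro independent_card_le_dim indep) auto
  then have m: "m \<le> ptan_dim_at A x"
    using inj by (simp add: card_image ptan_dim_at_def)
  have "(\<Sum>i=1..m. proj_theta A x (\<xi> i)) \<le> (\<Sum>i=1..m. ereal 1)"
    by (intro sum_mono) (simp add: proj_theta_le_1 flip: one_ereal_def)
  also have "\<dots> = ereal (real m)"
    by (simp only: sum_ereal) simp
  also have "\<dots> \<le> ereal (real (ptan_dim_at A x))"
    using m by simp
  finally show "(\<Sum>i=1..m. proj_theta A x (\<xi> i)) \<le> ereal (real (ptan_dim_at A x))" .
qed

section \<open>Segments in \<open>A\<close> as probes, and the bound from below\<close>

text \<open>Along points \<open>x + l k *\<^sub>R w\<close> of the segment the difference quotients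
  are constantly \<open>w\<close>.\<close>

lemma segment_in_tangent_cone:
  assumes \<delta>: "0 < \<delta>" and seg: "\<And>t. 0 < t \<Longrightarrow> t < \<delta> \<Longrightarrow> x + t *\<^sub>R w \<in> A"
  shows "w \<in> tangent_cone A x"
proof -
  \<comment> \<open>The shift by 2 makes already \<open>l 0 = \<delta> / 2\<close> smaller than
    \<delta>; a shift by 1 would start at the excluded endpoint.\<close>
  define l where "l k = \<delta> / (real k + 2)" for k :: nat
  have l0: "l \<longlonglongrightarrow> 0"
    unfolding l_def by real_asymp
  have lpos: "0 < l k" and lless: "l k < \<delta>" for k
    using \<delta> by (auto simp: l_def field_simps add_pos_nonneg)
  have dec: "decseq l"
    using \<delta> by (auto simp: l_def decseq_def intro!: divide_left_mono)
  have "(\<lambda>k. x + l k *\<^sub>R w) \<longlonglongrightarrow> x + 0 *\<^sub>R w"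
    by (intro tendsto_intros l0)
  moreover have "((x + l k *\<^sub>R w) - x) /\<^sub>R l k = w" for k
    using lpos[of k] by simp
  ultimately show ?thesis
    unfolding tangent_cone_def
    using seg lpos lless dec l0
    by (intro CollectI exI[of _ "\<lambda>k. x + l k *\<^sub>R w"] exI[of _ l]) auto
qed

lemma theta_segment_ge_1:
  fixes x w :: "real ^ 'n"
  assumes w: "norm w = 1" and \<delta>: "0 < \<delta>"
    and seg: "\<And>t. 0 < t \<Longrightarrow> t < \<delta> \<Longrightarrow> x + t *\<^sub>R w \<in> A"
  shows "1 \<le> theta A x w"
proof -
  \<comment> \<open>Probes live on closed intervals, whereas the segment is open at \<delta>;
    halving keeps the far endpoint inside \<open>A\<close>.\<close>
  define d where "d = \<delta> / 2"
  have d: "0 < d" "d < \<delta>"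
    using \<delta> by (auto simp: d_def)
  define \<gamma> where "\<gamma> t = x + t *\<^sub>R w" for t
  define E where "E = A \<inter> \<gamma> ` {0..d}"
  have E: "\<gamma> t \<in> E" if "0 < t" "t \<le> d" for t
    using that seg d by (auto simp: E_def \<gamma>_def)
  have dist_\<gamma>: "dist (\<gamma> s) (\<gamma> t) = \<bar>s - t\<bar>" for s t
    using w by (simp add: \<gamma>_def dist_norm flip: scaleR_diff_left)
  have "(d, \<gamma>) \<in> probes A x w"
  proof -
    have "w \<noteq> 0"
      using w by auto
    then have "inj_on \<gamma> {0..d}"
      by (auto simp: inj_on_def \<gamma>_def)
    moreover have "1-lipschitz_on {0..d} \<gamma>"
      by (auto simp: lipschitz_on_def dist_\<gamma> dist_real_def)
    moreover have "((\<lambda>t. (\<gamma> t - x) /\<^sub>R norm (\<gamma> t - x)) \<longlongrightarrow> w) (at_right 0)"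
    proof (rule tendsto_eventually)
      show "eventually (\<lambda>t. (\<gamma> t - x) /\<^sub>R norm (\<gamma> t - x) = w) (at_right 0)"
        using eventually_at_right_less[of "0::real"]
        by (rule eventually_mono) (use w in \<open>auto simp: \<gamma>_def\<close>)
    qed
    moreover have "A \<inter> \<gamma> ` {0<..\<eta>} \<noteq> {}" if "\<eta> \<in> {0<..d}" for \<eta>
      using that E[of \<eta>] by (auto simp: E_def)
    ultimately show ?thesis
      using d by (auto simp: probes_def \<gamma>_def)
  qed
  then have "pbox_dim_at E x \<le> theta A x w"
    unfolding theta_def E_def by (intro SUP_upper2[of "(d, \<gamma>)"]) auto
  \<comment> \<open>The point \<open>x\<close> need not belong to \<open>A\<close>, so it is
    approached along the segment. Outside the closure \<open>pbox_dim_at\<close> would take its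
    default value 0.\<close>
  moreover have "x \<in> closure E"
    unfolding closure_approachable
  proof (intro allI impI)
    fix e :: real assume "0 < e"
    then have "\<gamma> (min d (e/2)) \<in> E" "dist (\<gamma> (min d (e/2))) (\<gamma> 0) < e"
      using E d by (auto simp: dist_\<gamma>)
    then show "\<exists>y\<in>E. dist y x < e"
      by (auto simp: \<gamma>_def)
  qed
  moreover have "1 \<le> upper_box_dim (E \<inter> ball x r)" if "0 < r" for r
  \<comment> \<open>The length \<open>min d r\<close> keeps the subsegment both in the image of the
    probe and in the ball.\<close>
  proof (rule upper_box_dim_segment_ge_1[of _ w "min d r"])
    show "x + t *\<^sub>R w \<in> E \<inter> ball x r" if "0 < t" "t < min d r" for t
      using that E[of t] dist_\<gamma>[of 0 t] by (auto simp: \<gamma>_def)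
  qed (use w d that in \<open>auto intro: bounded_Int\<close>)
  ultimately show ?thesis
    by (auto simp: pbox_dim_at_def le_INF_iff elim!: order_trans[rotated])
qed

text \<open>Effective directions are unit vectors, so \<open>v\<close> is normalised: this keeps the
  line and rescales the parameter length to \<open>\<delta> * norm v\<close>.\<close>

lemma proj_theta_segment_ge_1:
  fixes x v :: "real ^ 'n"
  assumes x: "x \<in> closure A" and v: "v \<noteq> 0" and \<delta>: "0 < \<delta>"
    and seg: "{x + t *\<^sub>R v | t. 0 < t \<and> t < \<delta>} \<subseteq> A"
  shows "span {v} \<in> proj_eff_dirs A x" and "1 \<le> proj_theta A x (span {v})"
proof -
  define w where "w = v /\<^sub>R norm v"
  have w: "norm w = 1" and d: "0 < \<delta> * norm v"
    using v \<delta> by (auto simp: w_def)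
  have segw: "x + t *\<^sub>R w \<in> A" if "0 < t" "t < \<delta> * norm v" for t
  proof -
    have "0 < t / norm v" "t / norm v < \<delta>"
      using that v by (auto simp: field_simps)
    then have "x + (t / norm v) *\<^sub>R v \<in> A"
      using seg by blast
    then show ?thesis
      by (simp add: w_def divide_inverse)
  qed
  have eff: "w \<in> eff_dirs A x"
    using segment_in_tangent_cone[OF d segw] x w by (simp add: eff_dirs_def)
  have span: "span {w} = span {v}"
    unfolding w_def using v span_image_scale[of "{v}" "\<lambda>_. inverse (norm v)"] by simp
  show "span {v} \<in> proj_eff_dirs A x"
    using eff span by (auto simp: proj_eff_dirs_def)
  show "1 \<le> proj_theta A x (span {v})"
    unfolding proj_theta_def using eff span theta_segment_ge_1[OF w d segw]
    by (intro SUP_upper2[of w]) auto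
qed

text \<open>The lines \<open>span {v i}\<close> are one of the families competing in the supremum,
  and each contributes at least 1.\<close>

lemma pvec_admissible_le_cross_dim_at:
  fixes A :: "(real ^ 'n) set"
  assumes x: "x \<in> closure A" and k: "k \<le> CARD('n)" and adm: "pvec_admissible A x k"
  shows "ereal (real k) \<le> cross_dim_at A x"
proof -
  obtain v \<delta> where indep: "lin_indep_family k v" and \<delta>: "0 < \<delta>"
    and seg: "\<And>i. i \<in> {1..k} \<Longrightarrow> {x + t *\<^sub>R v i | t. 0 < t \<and> t < \<delta>} \<subseteq> A"
    using adm unfolding pvec_admissible_def by blast
  have nz: "v i \<noteq> 0" if "i \<in> {1..k}" for i
    using indep dependent_zero[of "v ` {1..k}"] that by (force simp: lin_indep_family_def)
  have ind: "proj_indep k (\<lambda>i. span {v i})"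
    using indep nz unfolding proj_indep_def by blast
  have "ereal (real k) = (\<Sum>i=1..k. ereal 1)"
    by (simp only: sum_ereal) simp
  also have "\<dots> \<le> (\<Sum>i=1..k. proj_theta A x (span {v i}))"
    using proj_theta_segment_ge_1(2)[OF x nz \<delta> seg]
    by (intro sum_mono) (simp flip: one_ereal_def)
  also have "\<dots> \<le> cross_dim_at A x"
    unfolding cross_dim_at_def
    using k ind proj_theta_segment_ge_1(1)[OF x nz \<delta> seg]
    by (intro Sup_upper CollectI exI[of _ k] exI[of _ "\<lambda>i. span {v i}"]) auto
  finally show ?thesis .
qed

lemma pvec_dim_at_le_cross_dim_at:
  fixes A :: "(real ^ 'n) set"
  assumes x: "x \<in> closure A"
  shows "ereal (real (pvec_dim_at A x)) \<le> cross_dim_at A x"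
proof -
  define K where "K = {k \<in> {1..CARD('n)}. pvec_admissible A x k}"
  \<comment> \<open>The empty family is vacuously admissible, so the default value 0 of
    \<open>pvec_dim_at\<close> falls under the same lemma as the maximum.\<close>
  have "pvec_admissible A x 0"
    by (auto simp: pvec_admissible_def lin_indep_family_def independent_empty intro: exI[of _ 1])
  moreover have "Max K \<in> K" if "K \<noteq> {}"
    using that by (intro Max_in) (auto simp: K_def)
  ultimately have "pvec_dim_at A x \<le> CARD('n) \<and> pvec_admissible A x (pvec_dim_at A x)"
    by (auto simp: pvec_dim_at_def Let_def K_def)
  then show ?thesis
    using pvec_admissible_le_cross_dim_at[OF x] by blast
qed

theorem corollary3p49:
  fixes A :: "(real ^ 'n) set"
  shows "(\<forall>x\<in>closure A.
            ereal (real (pvec_dim_at A x)) \<le> cross_dim_at A x \<and>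
            cross_dim_at A x \<le> ereal (real (ptan_dim_at A x))) \<and>
         pvec_dim A \<le> cross_dim A \<and> cross_dim A \<le> ptan_dim A"
  using pvec_dim_at_le_cross_dim_at[of _ A] cross_dim_at_le_ptan_dim_at[of A]
  by (auto simp: pvec_dim_def cross_dim_def ptan_dim_def intro!: SUP_mono)

end
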